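(* There exist graphs $G,G'$ such that $G'$ is obtained from $G$ by adding one edge and $\lambda(G,K_2)>\lambda(G',K_2)$.
   Context: All graphs are finite and simple. For a graph $G$, $d_v$ denotes the degree of $v$, $u\sim v$ means adjacency, and $\mathrm{vol}(G)=\sum_v d_v$. For a metric space $(X,d)$ and $f:V(G)\to X$ set $R_f(G,X)=\frac{\mathrm{vol}(G)\sum_{u\sim v} d(f(u),f(v))^2}{\sum_{u,v} d(f(u),f(v))^2 d_u d_v}$, where the numerator sum is over edges of $G$ and the denominator sum over unordered pairs of vertices; $\lambda(G,X)=\inf_f R_f(G,X)$ over all $f$ with nonzero denominator. $K_2$ is regarded as a two-point metric space with distance $1$. *)

theory Defs
  imports "HOL-Analysis.Analysis" "HOL-Library.Ramsey"
begin

text \<open>A finite simple graph is given by its vertex set and its set of edges; an edge is a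
  two-element set of vertices (\<^const>\<open>nsets\<close>).\<close>

definition fin_simple_graph :: "'a set \<Rightarrow> 'a set set \<Rightarrow> bool" where
  "fin_simple_graph V E \<longleftrightarrow> finite V \<and> E \<subseteq> nsets V 2"

definition deg :: "'a set set \<Rightarrow> 'a \<Rightarrow> nat" where
  "deg E v = card {e \<in> E. v \<in> e}"

definition vol :: "'a set \<Rightarrow> 'a set set \<Rightarrow> nat" where
  "vol V E = (\<Sum>v\<in>V. deg E v)"

text \<open>For symmetric \<open>g\<close>, the sum of \<open>g u v\<close> over the unordered pairs \<open>{u, v}\<close> in \<open>P\<close>: every
  two-element set is met by two ordered pairs, hence the factor 1/2.\<close>

definition sum_pairs :: "('a \<Rightarrow> 'a \<Rightarrow> real) \<Rightarrow> 'a set set \<Rightarrow> real" where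
  "sum_pairs g P = (\<Sum>(u, v) \<in> {(u, v). {u, v} \<in> P}. g u v) / 2"

lemma sum_pairs_eq_sum:
  assumes "finite V" "P \<subseteq> nsets V 2" and g: "\<And>u v. {u, v} \<in> P \<Longrightarrow> g u v = h {u, v}"
  shows "sum_pairs g P = (\<Sum>p\<in>P. h p)"
proof -
  have fP: "finite P"
    using assms finite_imp_finite_nsets finite_subset by blast
  have two: "\<exists>a b. a \<noteq> b \<and> p = {a, b} \<and> {(u, v). {u, v} = p} = {(a, b), (b, a)}" if p: "p \<in> P" for p
  proof -
    obtain a b where "p = {a, b}" "a \<noteq> b"
      using subsetD[OF assms(2) p] by (auto elim: nsets2_E)
    moreover from this have "{(u, v). {u, v} = p} = {(a, b), (b, a)}"
      by (auto simp: doubleton_eq_iff)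
    ultimately show ?thesis by blast
  qed
  have "(\<Sum>(u, v) \<in> {(u, v). {u, v} \<in> P}. g u v)
      = (\<Sum>(u, v) \<in> (\<Union>p\<in>P. {(u, v). {u, v} = p}). h {u, v})"
    by (rule sum.cong) (auto simp: g)
  also have "\<dots> = (\<Sum>p\<in>P. \<Sum>(u, v) \<in> {(u, v). {u, v} = p}. h {u, v})"
  proof (rule sum.UNION_disjoint[OF fP])
    show "\<forall>p\<in>P. finite {(u, v). {u, v} = p}"
      using two by (metis finite.emptyI finite.insertI)
  qed auto
  also have "\<dots> = (\<Sum>p\<in>P. 2 * h p)"
  proof (rule sum.cong[OF refl])
    fix p assume "p \<in> P"
    from two[OF this] obtain a b
      where ab: "a \<noteq> b" "p = {a, b}" and eq: "{(u, v). {u, v} = p} = {(a, b), (b, a)}"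
      by (elim exE conjE)
    show "(\<Sum>(u, v) \<in> {(u, v). {u, v} = p}. h {u, v}) = 2 * h p"
      unfolding eq using ab by (simp add: insert_commute)
  qed
  finally show ?thesis
    by (simp add: sum_pairs_def flip: sum_distrib_left)
qed

text \<open>The pairs of equal vertices do not occur in \<open>nsets V 2\<close>; their distance is 0 anyway.\<close>

definition rayleigh_denom :: "'a set \<Rightarrow> 'a set set \<Rightarrow> 'x metric \<Rightarrow> ('a \<Rightarrow> 'x) \<Rightarrow> real" where
  "rayleigh_denom V E X f =
    sum_pairs (\<lambda>u v. (mdist X (f u) (f v))\<^sup>2 * real (deg E u) * real (deg E v)) (nsets V 2)"

definition rayleigh :: "'a set \<Rightarrow> 'a set set \<Rightarrow> 'x metric \<Rightarrow> ('a \<Rightarrow> 'x) \<Rightarrow> real" where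
  "rayleigh V E X f =
    real (vol V E) * sum_pairs (\<lambda>u v. (mdist X (f u) (f v))\<^sup>2) E / rayleigh_denom V E X f"

definition admissible :: "'a set \<Rightarrow> 'a set set \<Rightarrow> 'x metric \<Rightarrow> ('a \<Rightarrow> 'x) set" where
  "admissible V E X = {f \<in> V \<rightarrow> mspace X. rayleigh_denom V E X f \<noteq> 0}"

text \<open>The quotients are nonnegative, so this infimum is the intended one whenever
  \<^const>\<open>admissible\<close> is nonempty; the real infimum of the empty set is an unspecified number, so
  statements about \<open>spectral_gap\<close> have to require nonemptiness.\<close>

definition spectral_gap :: "'a set \<Rightarrow> 'a set set \<Rightarrow> 'x metric \<Rightarrow> real" where
  "spectral_gap V E X = (INF f \<in> admissible V E X. rayleigh V E X f)"

definition K2_metric :: "bool metric" where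
  "K2_metric = metric (UNIV, discrete_metric.dd)"

lemma mspace_K2_metric [simp]: "mspace K2_metric = UNIV"
  by (simp add: K2_metric_def Metric_space.mspace_metric metric_M_dd)

lemma mdist_K2_metric: "mdist K2_metric x y = (if x = y then 0 else 1)"
  unfolding K2_metric_def Metric_space.mdist_metric[OF metric_M_dd]
  by (simp add: discrete_metric.dd_def)

end

theory Submission
  imports Defs
begin

text \<open>For \<open>f\<close> into \<open>K\<^sub>2\<close> cutting the graph into sides of volumes \<open>a\<close> and \<open>b\<close>, with \<open>c\<close> edges across,
  the Rayleigh quotient is \<open>c (1/a + 1/b)\<close>. Adding an edge inside one side of an optimal cut keeps
  \<open>c\<close> and enlarges \<open>a\<close> or \<open>b\<close>, so the quotient of that cut drops. In the star \<open>K\<^sub>1\<^sub>,\<^sub>3\<close> with centre \<open>0\<close>, a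
  cut separating \<open>k\<close> leaves from the centre has quotient \<open>6/(6 - k)\<close>, so cutting off the single leaf
  \<open>3\<close> is optimal, with value \<open>6/5\<close>; adding the edge \<open>{1, 2}\<close> lowers it to \<open>8/7\<close>.\<close>

lemma sum_pairs_empty [simp]: "sum_pairs g {} = 0"
  by (simp add: sum_pairs_def)

text \<open>The two orientations of \<open>{a, b}\<close> cancel the factor 1/2. Used as a rewrite
  rule, this evaluates sums over explicit edge sets one edge at a time.\<close>

lemma sum_pairs_insert:
  assumes fin: "finite (\<Union>P)" and ab: "a \<noteq> b" "{a, b} \<notin> P" and sym: "g a b = g b a"
  shows "sum_pairs g (insert {a, b} P) = g a b + sum_pairs g P"
proof -
  let ?D = "{(u, v). {u, v} \<in> P}"
  have "?D \<subseteq> \<Union>P \<times> \<Union>P" by auto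
  then have finD: "finite ?D"
    using fin by (meson finite_SigmaI finite_subset)
  have eq: "{(u, v). {u, v} \<in> insert {a, b} P} = insert (a, b) (insert (b, a) ?D)"
    by (auto simp: doubleton_eq_iff)
  have "(a, b) \<notin> insert (b, a) ?D" "(b, a) \<notin> ?D"
    using ab by (auto simp: insert_commute)
  then show ?thesis
    unfolding sum_pairs_def eq using finD sym by (simp add: field_simps)
qed

lemma sum_pairs_nonneg:
  assumes "\<And>u v. 0 \<le> g u v"
  shows "0 \<le> sum_pairs g P"
  unfolding sum_pairs_def by (intro divide_nonneg_pos sum_nonneg) (auto simp: assms)

lemma rayleigh_nonneg: "0 \<le> rayleigh V E X f"
  unfolding rayleigh_def rayleigh_denom_def
  by (intro divide_nonneg_nonneg mult_nonneg_nonneg sum_pairs_nonneg) auto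

lemma spectral_gap_le_rayleigh:
  assumes "f \<in> admissible V E X"
  shows "spectral_gap V E X \<le> rayleigh V E X f"
  unfolding spectral_gap_def
  \<comment> \<open>A real infimum is a lower bound only if the values are bounded below; here 0
    serves.\<close>
  by (rule cINF_lower[OF bdd_belowI2[where m = 0] assms]) (rule rayleigh_nonneg)

lemma deg_empty [simp]: "deg {} v = 0"
  by (simp add: deg_def)

lemma deg_insert:
  assumes "finite E" "e \<notin> E"
  shows "deg (insert e E) v = (if v \<in> e then 1 else 0) + deg E v"
proof -
  have "{x \<in> insert e E. v \<in> x} = (if v \<in> e then insert e {x \<in> E. v \<in> x} else {x \<in> E. v \<in> x})"
    by auto
  then show ?thesis
    using assms by (simp add: deg_def)
qed

lemma nsets_insert_2:
  assumes "a \<notin> V"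
  shows "nsets (insert a V) 2 = (\<lambda>b. {a, b}) ` V \<union> nsets V 2"
  using assms by (auto simp: nsets_2_eq insert_commute)

definition star :: "nat set set" where
  "star = {{0, 1}, {0, 2}, {0, 3}}"

definition paw :: "nat set set" where
  "paw = insert {1, 2} star"

lemma nsets_4: "nsets {0, 1, 2, 3 :: nat} 2 = {{0, 1}, {0, 2}, {0, 3}, {1, 2}, {1, 3}, {2, 3}}"
  by (simp add: nsets_insert_2 insert_commute)

lemma deg_star: "deg star 0 = 3" "deg star 1 = 1" "deg star 2 = 1" "deg star 3 = 1"
  by (simp_all add: star_def deg_insert doubleton_eq_iff)

lemma deg_paw: "deg paw 0 = 3" "deg paw 1 = 2" "deg paw 2 = 2" "deg paw 3 = 1"
  by (simp_all add: paw_def star_def deg_insert doubleton_eq_iff)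

lemma rayleigh_star_ge:
  assumes "f \<in> admissible {0, 1, 2, 3} star K2_metric"
  shows "6 / 5 \<le> rayleigh {0, 1, 2, 3} star K2_metric f"
proof -
  have vol: "vol {0, 1, 2, 3} star = 6"
    using deg_star by (simp add: vol_def)
  show ?thesis
    using assms deg_star
    unfolding admissible_def rayleigh_def rayleigh_denom_def nsets_4 vol
    unfolding star_def
    \<comment> \<open>All 16 two-colourings of the vertices are checked; the two constant ones have
      denominator 0 and so contradict admissibility.\<close>
    by (cases "f 0"; cases "f 1"; cases "f 2"; cases "f 3";
      simp add: sum_pairs_insert mdist_K2_metric doubleton_eq_iff)
qed

lemma
  shows admissible_star: "(\<lambda>v. v = 3) \<in> admissible {0, 1, 2, 3} star K2_metric"
    and admissible_paw: "(\<lambda>v. v = 3) \<in> admissible {0, 1, 2, 3} paw K2_metric"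
    and rayleigh_paw: "rayleigh {0, 1, 2, 3} paw K2_metric (\<lambda>v. v = 3) = 8 / 7"
proof -
  have vol: "vol {0, 1, 2, 3} paw = 8"
    using deg_paw by (simp add: vol_def)
  \<comment> \<open>For a cut, the denominator is the product of the volumes of its sides: 1 * 5 in
    the star, 1 * 7 in the paw.\<close>
  have "rayleigh_denom {0, 1, 2, 3} star K2_metric (\<lambda>v. v = 3) = 5"
    and d: "rayleigh_denom {0, 1, 2, 3} paw K2_metric (\<lambda>v. v = 3) = 7"
    using deg_star deg_paw unfolding rayleigh_denom_def nsets_4
    by (simp_all add: sum_pairs_insert mdist_K2_metric doubleton_eq_iff)
  then show "(\<lambda>v. v = 3) \<in> admissible {0, 1, 2, 3} star K2_metric"
    "(\<lambda>v. v = 3) \<in> admissible {0, 1, 2, 3} paw K2_metric"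
    by (simp_all add: admissible_def)
  show "rayleigh {0, 1, 2, 3} paw K2_metric (\<lambda>v. v = 3) = 8 / 7"
    unfolding rayleigh_def d vol unfolding paw_def star_def
    by (simp add: sum_pairs_insert mdist_K2_metric doubleton_eq_iff)
qed

theorem theorem6p4:
  shows "\<exists>(V :: nat set) E E'.
    fin_simple_graph V E \<and> fin_simple_graph V E' \<and>
    (\<exists>e \<in> nsets V 2 - E. E' = insert e E) \<and>
    admissible V E K2_metric \<noteq> {} \<and> admissible V E' K2_metric \<noteq> {} \<and>
    spectral_gap V E K2_metric > spectral_gap V E' K2_metric"
proof (intro exI conjI)
  let ?V = "{0, 1, 2, 3 :: nat}"
  show "fin_simple_graph ?V star" "fin_simple_graph ?V paw"
    unfolding fin_simple_graph_def nsets_4 by (auto simp: paw_def star_def)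
  show "\<exists>e \<in> nsets ?V 2 - star. paw = insert e star"
    unfolding nsets_4 paw_def
    by (rule bexI[of _ "{1, 2}"]) (auto simp: star_def doubleton_eq_iff)
  show nonempty: "admissible ?V star K2_metric \<noteq> {}" "admissible ?V paw K2_metric \<noteq> {}"
    using admissible_star admissible_paw by blast+
  \<comment> \<open>One cut bounds the infimum for \<open>paw\<close> from above; the bound for
    \<open>star\<close> ranges over all cuts.\<close>
  have "spectral_gap ?V paw K2_metric \<le> 8 / 7"
    using spectral_gap_le_rayleigh[OF admissible_paw] by (simp only: rayleigh_paw)
  moreover have "6 / 5 \<le> spectral_gap ?V star K2_metric"
    unfolding spectral_gap_def by (rule cINF_greatest[OF nonempty(1) rayleigh_star_ge])
  ultimately show "spectral_gap ?V paw K2_metric < spectral_gap ?V star K2_metric"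
    by linarith
qed

end
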